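(* Let $k\ge3$, let $\mathcal T_H\in\mathbb T$ and let $\mathcal T_h\in\mathbb T$ be a refinement of $\mathcal T_H$. Then the extended bending moment spaces are nested: $$\widetilde\Sigma_H\subset\widetilde\Sigma_h .$$
   Context: $\Omega\subset\mathbb R^2$ is a bounded, simply connected Lipschitz polygonal domain. $\mathbb S$ is the space of symmetric real $2\times2$ matrices, the divergence of a matrix field is row-wise, and $H(\operatorname{div}\operatorname{div},\Omega;\mathbb S)=\{\bm\tau\in L^2(\Omega;\mathbb S):\operatorname{div}\operatorname{div}\bm\tau\in L^2(\Omega)\}$. $\mathcal T_0$ is an initial shape-regular triangulation of $\Omega$ with vertex set $\mathcal V_0$, and $\mathbb T$ is the set of all admissible (conforming) triangulations obtained from $\mathcal T_0$ by finitely many successive newest vertex bisections. For $\mathcal T_h\in\mathbb T$: $\mathcal V_h$ is the set of vertices, $\mathcal E_h(\Omega)$ the set of interior edges; each edge $e$ has a fixed unit normal $\mathbf n_e$ (outward if $e\subset\partial\Omega$) and unit tangent $\mathbf t_e=\mathbf n_e^\perp$; $[\![\cdot]\!]_e$ is the jump across $e$. Every vertex in $\mathcal V_h\setminus\mathcal V_0$ is created by bisection as the midpoint of some old edge $e$ and is denoted $\mathbf x_e$, with associated $\mathbf n_e,\mathbf t_e$. Put $$\omega_{\mathbf x_e}^{\pm}=\bigcup\{K\in\mathcal T_h:\mathbf x_e\in K,\ \pm(\operatorname{mid}(K)-\mathbf x_e)\cdot\mathbf n_e>0\}$$ ($\operatorname{mid}(K)$ is the barycenter; $\omega_{\mathbf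 x_e}^+=\emptyset$ if $e\subset\partial\Omega$). $\widetilde\Sigma_h$ is the set of $\bm\tau\in H(\operatorname{div}\operatorname{div},\Omega;\mathbb S)$ such that: $\bm\tau|_K\in P_k(K;\mathbb S)$ for all $K\in\mathcal T_h$; $\bm\tau$ is continuous at every $\mathbf x\in\mathcal V_0$; for every $\mathbf x_e\in\mathcal V_h\setminus\mathcal V_0$, $\mathbf t_e^{\mathrm T}\bm\tau\mathbf t_e$ is continuous at $\mathbf x_e$ within $\omega_{\mathbf x_e}^+$ and continuous at $\mathbf x_e$ within $\omega_{\mathbf x_e}^-$ (the two values may differ), and $\bm\tau\mathbf n_e$ is continuous at $\mathbf x_e$; and $[\![\bm\tau\mathbf n_e]\!]_e=\mathbf0$, $[\![\mathbf n_e^{\mathrm T}\operatorname{div}\bm\tau]\!]_e=0$ for all $e\in\mathcal E_h(\Omega)$. $\widetilde\Sigma_H$ is defined in the same way with respect to $\mathcal T_H$. *)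

theory Defs
  imports "HOL-Analysis.Analysis"
begin

type_synonym point = "real^2"
type_synonym matfield = "point \<Rightarrow> real^2^2"

definition perp :: "point \<Rightarrow> point" where
  "perp v = vector [- v $ 2, v $ 1]"


section \<open>Domains\<close>

text \<open>Near every boundary point the domain is, in an orthonormal frame, the strict subgraph of a
  Lipschitz function.\<close>

definition lipschitz_domain :: "point set \<Rightarrow> bool" where
  "lipschitz_domain \<Omega> \<longleftrightarrow> open \<Omega> \<and> connected \<Omega> \<and> \<Omega> \<noteq> {} \<and>
     (\<forall>x\<in>frontier \<Omega>. \<exists>\<nu> r h L g. norm \<nu> = 1 \<and> 0 < r \<and> 0 < h \<and>
        L-lipschitz_on {-r<..<r} g \<and> (\<forall>s\<in>{-r<..<r}. \<bar>g s\<bar> < h) \<and>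
        (\<forall>s\<in>{-r<..<r}. \<forall>t\<in>{-h<..<h}.
            x + s *\<^sub>R perp \<nu> + t *\<^sub>R \<nu> \<in> \<Omega> \<longleftrightarrow> t < g s))"

definition polygonal :: "point set \<Rightarrow> bool" where
  "polygonal \<Omega> \<longleftrightarrow>
     (\<exists>S. finite S \<and> (\<forall>s\<in>S. \<exists>a b. s = closed_segment a b) \<and> frontier \<Omega> = \<Union>S)"


section \<open>Meshes and newest vertex bisection\<close>

text \<open>A labelled triangle (z, a, b) has newest vertex z and refinement edge [a, b].\<close>

type_synonym ltri = "point \<times> point \<times> point"
type_synonym mesh = "ltri set"

fun tri :: "ltri \<Rightarrow> point set" where
  "tri (z, a, b) = convex hull {z, a, b}"

fun verts :: "ltri \<Rightarrow> point set" where
  "verts (z, a, b) = {z, a, b}"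

fun edges :: "ltri \<Rightarrow> point set set" where
  "edges (z, a, b) = {closed_segment z a, closed_segment z b, closed_segment a b}"

fun barycenter :: "ltri \<Rightarrow> point" where
  "barycenter (z, a, b) = (1/3) *\<^sub>R (z + a + b)"

definition mesh_verts :: "mesh \<Rightarrow> point set" where
  "mesh_verts T = (\<Union>t\<in>T. verts t)"

definition interior_edges :: "point set \<Rightarrow> mesh \<Rightarrow> point set set" where
  "interior_edges \<Omega> T = {e \<in> (\<Union>t\<in>T. edges t). \<not> e \<subseteq> frontier \<Omega>}"

text \<open>The library predicate \<open>triangulation\<close> contains finiteness and conformity (two cells meet in a
  common face); injectivity says that each triangle carries exactly one label. Shape regularity of
  a single finite mesh is automatic, the triangles being nondegenerate.\<close>

definition conforming_mesh :: "point set \<Rightarrow> mesh \<Rightarrow> bool" where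
  "conforming_mesh \<Omega> T \<longleftrightarrow> triangulation (tri ` T) \<and> (\<forall>t\<in>T. 2 simplex tri t) \<and>
     inj_on tri T \<and> \<Union> (tri ` T) = closure \<Omega>"

text \<open>Bisection of a single triangle; hanging nodes may occur at intermediate stages.\<close>

definition bisect :: "mesh \<Rightarrow> mesh \<Rightarrow> bool" where
  "bisect T T' \<longleftrightarrow> (\<exists>z a b. (z, a, b) \<in> T \<and>
     T' = T - {(z, a, b)} \<union> {(midpoint a b, z, a), (midpoint a b, z, b)})"

definition nvb_refines :: "mesh \<Rightarrow> mesh \<Rightarrow> bool" where
  "nvb_refines T T' \<longleftrightarrow> bisect\<^sup>*\<^sup>* T T'"

definition admissible :: "point set \<Rightarrow> mesh \<Rightarrow> mesh set" where
  "admissible \<Omega> T0 = {T. nvb_refines T0 T \<and> conforming_mesh \<Omega> T}"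

definition forest :: "mesh \<Rightarrow> mesh" where
  "forest T0 = \<Union> {T. nvb_refines T0 T}"

text \<open>The edges whose bisection creates the vertex x. If x is a vertex of some refinement of T0 but
  not of T0, this set has exactly one element, since all edges of the forest are dyadic
  subsegments of edges of T0 or of bisectors.\<close>

definition creating_edges :: "mesh \<Rightarrow> point \<Rightarrow> point set set" where
  "creating_edges T0 x =
     {closed_segment a b | z a b. (z, a, b) \<in> forest T0 \<and> midpoint a b = x}"

text \<open>A choice n of unit edge normals, outward on the boundary. It is fixed for all edges of all
  meshes at once.\<close>

definition edge_normals :: "point set \<Rightarrow> mesh \<Rightarrow> (point set \<Rightarrow> point) \<Rightarrow> bool" where
  "edge_normals \<Omega> T0 n \<longleftrightarrow> (\<forall>t\<in>forest T0. \<forall>e\<in>edges t.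
     norm (n e) = 1 \<and> (\<forall>x\<in>e. \<forall>y\<in>e. n e \<bullet> (x - y) = 0) \<and>
     (e \<subseteq> frontier \<Omega> \<longrightarrow> (\<forall>x\<in>rel_interior e.
        \<forall>\<^sub>F s in at_right 0. x + s *\<^sub>R n e \<notin> closure \<Omega> \<and> x - s *\<^sub>R n e \<in> \<Omega>)))"

text \<open>The triangles forming the patch of x on the side of \<open>\<nu>\<close>. For a creating edge on the boundary
  and its outward normal \<open>\<nu>\<close> it is empty.\<close>

definition side_patch :: "mesh \<Rightarrow> point \<Rightarrow> point \<Rightarrow> mesh" where
  "side_patch T x \<nu> = {t\<in>T. x \<in> tri t \<and> (barycenter t - x) \<bullet> \<nu> > 0}"


section \<open>Distributional div div\<close>

definition partial_deriv :: "2 \<Rightarrow> (point \<Rightarrow> real) \<Rightarrow> point \<Rightarrow> real" where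
  "partial_deriv i f x = frechet_derivative f (at x) (axis i 1)"

primrec Ck :: "nat \<Rightarrow> (point \<Rightarrow> real) \<Rightarrow> bool" where
  "Ck 0 f \<longleftrightarrow> continuous_on UNIV f"
| "Ck (Suc m) f \<longleftrightarrow> (\<forall>x. f differentiable (at x)) \<and> (\<forall>i. Ck m (partial_deriv i f))"

definition test_functions :: "point set \<Rightarrow> (point \<Rightarrow> real) set" where
  "test_functions \<Omega> = {\<phi>. (\<forall>m. Ck m \<phi>) \<and>
     compact (closure {x. \<phi> x \<noteq> 0}) \<and> closure {x. \<phi> x \<noteq> 0} \<subseteq> \<Omega>}"

definition L2 :: "point set \<Rightarrow> (point \<Rightarrow> real) set" where
  "L2 \<Omega> = {f. f \<in> borel_measurable (lebesgue_on \<Omega>) \<and>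
     integrable (lebesgue_on \<Omega>) (\<lambda>x. (f x)\<^sup>2)}"

definition L2_sym :: "point set \<Rightarrow> matfield set" where
  "L2_sym \<Omega> = {\<tau>. (\<forall>i j. (\<lambda>x. \<tau> x $ i $ j) \<in> L2 \<Omega>) \<and>
     (AE x in lebesgue_on \<Omega>. transpose (\<tau> x) = \<tau> x)}"

definition weak_divdiv :: "point set \<Rightarrow> matfield \<Rightarrow> (point \<Rightarrow> real) \<Rightarrow> bool" where
  "weak_divdiv \<Omega> \<tau> g \<longleftrightarrow> (\<forall>\<phi>\<in>test_functions \<Omega>.
     (LINT x|lebesgue_on \<Omega>. (\<Sum>i\<in>UNIV. \<Sum>j\<in>UNIV.
         \<tau> x $ i $ j * partial_deriv i (partial_deriv j \<phi>) x))
     = (LINT x|lebesgue_on \<Omega>. g x * \<phi> x))"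

definition Hdivdiv :: "point set \<Rightarrow> matfield set" where
  "Hdivdiv \<Omega> = {\<tau> \<in> L2_sym \<Omega>. \<exists>g\<in>L2 \<Omega>. weak_divdiv \<Omega> \<tau> g}"


section \<open>The extended bending moment space\<close>

definition poly_deg :: "nat \<Rightarrow> (point \<Rightarrow> real) \<Rightarrow> bool" where
  "poly_deg k f \<longleftrightarrow>
     (\<exists>c. \<forall>x. f x = (\<Sum>i\<le>k. \<Sum>j\<le>k - i. c i j * (x $ 1) ^ i * (x $ 2) ^ j))"

definition poly_sym :: "nat \<Rightarrow> matfield set" where
  "poly_sym k = {q. (\<forall>i j. poly_deg k (\<lambda>x. q x $ i $ j)) \<and> (\<forall>x. transpose (q x) = q x)}"

definition row_div :: "matfield \<Rightarrow> point \<Rightarrow> point" where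
  "row_div q x = (\<chi> i. \<Sum>j\<in>UNIV. partial_deriv j (\<lambda>y. q y $ i $ j) x)"

text \<open>A piecewise polynomial is given by its polynomial q t on each triangle t, so that q t x is the
  trace from t at a vertex or edge point x. Continuity at x within a union of triangles means that
  the traces from all these triangles at x coincide.\<close>

definition traces_agree_at :: "mesh \<Rightarrow> point \<Rightarrow> (ltri \<Rightarrow> point \<Rightarrow> 'b) \<Rightarrow> bool" where
  "traces_agree_at P x q \<longleftrightarrow>
     (\<forall>t\<in>P. \<forall>t'\<in>P. x \<in> tri t \<longrightarrow> x \<in> tri t' \<longrightarrow> q t x = q t' x)"

definition jump_vanishes :: "mesh \<Rightarrow> point set \<Rightarrow> (ltri \<Rightarrow> point \<Rightarrow> 'b) \<Rightarrow> bool" where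
  "jump_vanishes T e q \<longleftrightarrow>
     (\<forall>t\<in>T. \<forall>t'\<in>T. e \<in> edges t \<longrightarrow> e \<in> edges t' \<longrightarrow> (\<forall>x\<in>e. q t x = q t' x))"

text \<open>Fields are considered up to null sets: membership depends only on the a.e. class of \<open>\<tau>\<close> on
  \<open>\<Omega>\<close>, and the polynomials p t are determined by \<open>\<tau>\<close>.\<close>

definition ext_moment_space ::
  "point set \<Rightarrow> mesh \<Rightarrow> (point set \<Rightarrow> point) \<Rightarrow> nat \<Rightarrow> mesh \<Rightarrow> matfield set" where
  "ext_moment_space \<Omega> T0 n k T = {\<tau> \<in> Hdivdiv \<Omega>. \<exists>p :: ltri \<Rightarrow> matfield.
     (\<forall>t\<in>T. p t \<in> poly_sym k \<and> (AE x in lebesgue_on (tri t). \<tau> x = p t x)) \<and>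
     (\<forall>x\<in>mesh_verts T0. traces_agree_at T x p) \<and>
     (\<forall>x\<in>mesh_verts T - mesh_verts T0. \<forall>e\<in>creating_edges T0 x.
        traces_agree_at (side_patch T x (n e)) x
          (\<lambda>t y. perp (n e) \<bullet> (p t y *v perp (n e))) \<and>
        traces_agree_at (side_patch T x (- n e)) x
          (\<lambda>t y. perp (n e) \<bullet> (p t y *v perp (n e))) \<and>
        traces_agree_at T x (\<lambda>t y. p t y *v n e)) \<and>
     (\<forall>e\<in>interior_edges \<Omega> T.
        jump_vanishes T e (\<lambda>t y. p t y *v n e) \<and>
        jump_vanishes T e (\<lambda>t y. n e \<bullet> row_div (p t) y))}"

end

theory Submission
  imports Defs
begin

text \<open>Give every fine triangle the polynomial of its coarse ancestor. Only triangles with distinct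
  ancestors t, t' are of interest; these meet in a proper common face. An edge shared by two such
  triangles lies in a coarse edge, so its unit normal is the coarse one up to sign. At a new vertex x,
  the midpoint of some e, the tree structure of bisection shows that e avoids the interiors of t and t',
  so both lie on one side of the line through e. If x is a coarse vertex, the coarse conditions
  at x apply to t and t'; otherwise x is a relative interior point of a coarse edge, which is then
  parallel to e and separates t from t'.\<close>

section \<open>Plane geometry\<close>

lemma perp_inner_self : "perp w \<bullet> w = 0"
  by (simp add: perp_def inner_vec_def sum_2 vector_2)

lemma perp_eq_0_iff : "perp w = 0 \<longleftrightarrow> w = 0"
  by (auto simp: perp_def vec_eq_iff forall_2 vector_2)

text \<open>\<open>v\<close> and \<open>perp v\<close> form an orthonormal basis of the plane, and
  the \<open>v\<close>-component of \<open>w\<close> vanishes.\<close>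

lemma perp_expansion:
  fixes v w :: point
  assumes "v \<bullet> w = 0" "norm v = 1"
  shows "w = (w \<bullet> perp v) *\<^sub>R perp v"
proof -
  have v: "v$1 * v$1 + v$2 * v$2 = 1"
    using assms(2) by (simp add: norm_eq_1 inner_vec_def sum_2)
  have o: "v$1 * w$1 + v$2 * w$2 = 0"
    using assms(1) by (simp add: inner_vec_def sum_2)
  have "w$1 = (w$2 * v$1 - w$1 * v$2) * (- v$2)" "w$2 = (w$2 * v$1 - w$1 * v$2) * v$1"
    using v o by algebra+
  then show ?thesis
    by (simp add: perp_def vec_eq_iff forall_2 vector_2 inner_vec_def sum_2 algebra_simps)
qed

text \<open>In the plane the orthogonal complement of the nonzero vector \<open>w\<close> is a line,
  and the unit vector \<open>\<nu>\<close> spans it.\<close>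

lemma orthogonal_multiple:
  fixes v \<nu> w :: point
  assumes "w \<noteq> 0" "v \<bullet> w = 0" "\<nu> \<bullet> w = 0" "norm \<nu> = 1"
  shows "v = (v \<bullet> \<nu>) *\<^sub>R \<nu>"
proof -
  have n: "\<nu>$1 * \<nu>$1 + \<nu>$2 * \<nu>$2 = 1"
    using assms(4) by (simp add: norm_eq_1 inner_vec_def sum_2)
  have o: "\<nu>$1 * w$1 + \<nu>$2 * w$2 = 0" "v$1 * w$1 + v$2 * w$2 = 0"
    using assms by (simp_all add: inner_vec_def sum_2)
  have "w$1 \<noteq> 0 \<or> w$2 \<noteq> 0"
    using assms(1) by (auto simp: vec_eq_iff forall_2)
  \<comment> \<open>The determinant of \<open>v\<close> and \<open>\<nu>\<close>, times either
    coordinate of \<open>w\<close>, is a combination of the two orthogonality relations; one of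
    these coordinates is nonzero, so the determinant vanishes.\<close>
  moreover have "w$1 * (v$1 * \<nu>$2 - v$2 * \<nu>$1) = 0" "w$2 * (v$1 * \<nu>$2 - v$2 * \<nu>$1) = 0"
    using o by algebra+
  ultimately have d: "v$1 * \<nu>$2 - v$2 * \<nu>$1 = 0"
    by auto
  have "v$1 = (v$1 * \<nu>$1 + v$2 * \<nu>$2) * \<nu>$1" "v$2 = (v$1 * \<nu>$1 + v$2 * \<nu>$2) * \<nu>$2"
    using n d by algebra+
  then show ?thesis
    by (simp add: vec_eq_iff forall_2 inner_vec_def sum_2)
qed

lemma unit_normals_eq_up_to_sign:
  fixes v \<nu> w :: point
  assumes "w \<noteq> 0" "v \<bullet> w = 0" "\<nu> \<bullet> w = 0" "norm v = 1" "norm \<nu> = 1"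
  shows "v = \<nu> \<or> v = - \<nu>"
proof -
  have eq: "v = (v \<bullet> \<nu>) *\<^sub>R \<nu>"
    by (rule orthogonal_multiple) (use assms in auto)
  then have "\<bar>v \<bullet> \<nu>\<bar> * norm \<nu> = 1"
    using assms(4) by (metis norm_scaleR)
  then have "v \<bullet> \<nu> = 1 \<or> v \<bullet> \<nu> = - 1"
    using assms(5) by (auto simp: abs_if split: if_splits)
  with eq show ?thesis
    by (metis scaleR_minus1_left scaleR_one)
qed

text \<open>A line separates the segment from the interior of \<open>S\<close>. The midpoint lies
  both on the segment and in \<open>S\<close>, hence on this line; since neither endpoint lies
  beyond it, both endpoints are on it too. The separating line is therefore the one through
  \<open>a\<close> and \<open>b\<close>.\<close>

lemma one_side_of_segment:
  fixes S :: "point set" and \<nu> a b :: point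
  assumes "convex S" "interior S \<noteq> {}" "S \<subseteq> closure (interior S)"
    and x: "midpoint a b \<in> S" and ab: "a \<noteq> b"
    and disj: "interior S \<inter> closed_segment a b = {}"
    and \<nu>: "norm \<nu> = 1" "\<nu> \<bullet> (a - b) = 0"
  shows "(\<forall>y\<in>S. 0 \<le> \<nu> \<bullet> (y - midpoint a b)) \<or> (\<forall>y\<in>S. \<nu> \<bullet> (y - midpoint a b) \<le> 0)"
proof -
  let ?x = "midpoint a b"
  obtain v c where v: "v \<noteq> 0" and le: "\<forall>y\<in>closed_segment a b. v \<bullet> y \<le> c"
    and ge: "\<forall>y\<in>interior S. c \<le> v \<bullet> y"
    using separating_hyperplane_sets[of "closed_segment a b" "interior S"] assms
    by (metis convex_closed_segment convex_interior empty_iff ends_in_segment(1) inf_commute)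
  have "interior S \<subseteq> {y. c \<le> v \<bullet> y}"
    using ge by auto
  then have "closure (interior S) \<subseteq> {y. c \<le> v \<bullet> y}"
    by (rule closure_minimal) (rule closed_halfspace_ge)
  then have S: "c \<le> v \<bullet> y" if "y \<in> S" for y
    using assms(3) that by auto
  have "v \<bullet> a \<le> c" "v \<bullet> b \<le> c"
    using le by auto
  moreover have "c \<le> v \<bullet> ?x"
    using S x by auto
  moreover have "v \<bullet> ?x = (v \<bullet> a + v \<bullet> b) / 2"
    by (simp add: midpoint_def inner_add_right)
  ultimately have eq: "v \<bullet> (a - b) = 0" "v \<bullet> ?x = c"
    by (simp_all add: inner_diff_right)
  have "v = (v \<bullet> \<nu>) *\<^sub>R \<nu>"
    by (rule orthogonal_multiple[of "a - b"]) (use ab eq \<nu> in auto)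
  then obtain r where r: "v = r *\<^sub>R \<nu>"
    by blast
  have "0 \<le> r * (\<nu> \<bullet> (y - ?x))" if "y \<in> S" for y
    using S[OF that] eq(2) unfolding r by (simp add: inner_diff_right algebra_simps)
  then show ?thesis
    using v r by (cases "r > 0") (auto simp: zero_le_mult_iff)
qed

text \<open>Reflect an interior point \<open>y\<close> of the segment in the midpoint. The image
  \<open>y'\<close> lies in \<open>S\<close>, and the open segment from an interior point to a point
  of the closure stays in the interior.\<close>

lemma midpoint_in_interior_if_segment_meets_interior:
  fixes S :: "'a::euclidean_space set"
  assumes "convex S" "closed_segment a b \<subseteq> S" "interior S \<inter> closed_segment a b \<noteq> {}"
  shows "midpoint a b \<in> interior S"
proof -
  obtain y where y: "y \<in> interior S" "y \<in> closed_segment a b"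
    using assms(3) by blast
  then obtain u where u: "0 \<le> u" "u \<le> 1" "y = (1 - u) *\<^sub>R a + u *\<^sub>R b"
    by (auto simp: closed_segment_def)
  define y' where "y' = (1 - (1 - u)) *\<^sub>R a + (1 - u) *\<^sub>R b"
  have "y' \<in> closed_segment a b"
    unfolding closed_segment_def y'_def using u by (intro CollectI exI[of _ "1 - u"]) auto
  then have y': "y' \<in> closure S"
    using assms(2) closure_subset by blast
  have mid: "midpoint y y' = midpoint a b"
    by (simp add: midpoint_def u y'_def algebra_simps)
  show ?thesis
  proof (cases "y = y'")
    case True
    then show ?thesis using mid y by simp
  next
    case False
    then have "midpoint a b \<in> open_segment y y'"
      by (metis mid midpoint_in_open_segment)
    then show ?thesis
      using in_interior_closure_convex_segment[OF assms(1) y(1) y'] by blast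
  qed
qed

section \<open>Labelled triangles\<close>

text \<open>Affine independence of the vertices, in terms of linear functionals: in this form it
  passes to children by evaluating a functional at a midpoint.\<close>

definition noncollinear :: "ltri \<Rightarrow> bool" where
  "noncollinear t \<longleftrightarrow> (\<forall>v c. (\<forall>y\<in>verts t. v \<bullet> y = c) \<longrightarrow> v = 0)"

lemma tri_eq_hull: "tri t = convex hull (verts t)"
  by (cases t) auto

lemma finite_verts [simp]: "finite (verts t)"
  by (cases t) auto

lemma convex_tri [simp]: "convex (tri t)"
  by (simp add: tri_eq_hull)

lemma compact_tri [simp]: "compact (tri t)"
  by (simp add: tri_eq_hull finite_imp_compact_convex_hull)

lemma verts_subset_tri: "verts t \<subseteq> tri t"
  by (simp add: tri_eq_hull hull_subset)

lemma tri_sets_lebesgue [simp]: "tri t \<in> sets lebesgue"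
  by (simp add: fmeasurableD lmeasurable_compact)

text \<open>Treats the three edges of a labelled triangle uniformly, with \<open>w\<close> the
  vertex opposite to the edge.\<close>

lemma edge_cases:
  assumes "f \<in> edges t"
  obtains w c d where "f = closed_segment c d" "verts t = {w, c, d}"
proof -
  obtain z a b where t: "t = (z, a, b)"
    by (cases t)
  show thesis
    using assms that[where w = z and c = a and d = b]
      that[where w = b and c = z and d = a] that[where w = a and c = z and d = b]
    by (auto simp: t insert_commute)
qed

lemma edge_subset_tri: "f \<in> edges t \<Longrightarrow> f \<subseteq> tri t"
proof (erule edge_cases)
  fix w c d
  assume "f = closed_segment c d" "verts t = {w, c, d}"
  then show "f \<subseteq> tri t"
    by (simp add: tri_eq_hull segment_convex_hull hull_mono)
qed

lemma barycenter_in_tri: "barycenter t \<in> tri t"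
proof -
  obtain z a b where t: "t = (z, a, b)"
    by (cases t)
  show ?thesis
    unfolding t tri.simps barycenter.simps convex_hull_3
    by (intro CollectI exI[of _ "1/3"]) (simp add: algebra_simps)
qed

lemma tri_subset_halfplane:
  assumes "\<forall>y\<in>verts t. v \<bullet> y \<le> c"
  shows "\<forall>y\<in>tri t. v \<bullet> y \<le> c"
proof -
  have "convex hull (verts t) \<subseteq> {y. v \<bullet> y \<le> c}"
    using assms by (intro hull_minimal) (auto simp: convex_halfspace_le)
  then show ?thesis
    by (auto simp: tri_eq_hull)
qed

text \<open>The height of the barycenter is the average of the vertex heights, which are all
  nonnegative. If it were not positive, all vertices and hence the whole triangle would have height
  zero, contrary to \<open>y\<close>.\<close>

lemma barycenter_strictly_on_side:
  assumes y: "y \<in> tri t" "0 < \<nu> \<bullet> (y - x)" and side: "\<forall>y\<in>tri t. 0 \<le> \<nu> \<bullet> (y - x)"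
  shows "0 < \<nu> \<bullet> (barycenter t - x)"
proof (rule ccontr)
  assume neg: "\<not> ?thesis"
  obtain z a b where t: "t = (z, a, b)"
    by (cases t)
  have "0 \<le> \<nu> \<bullet> (z - x)" "0 \<le> \<nu> \<bullet> (a - x)" "0 \<le> \<nu> \<bullet> (b - x)"
    using side verts_subset_tri[of t] by (auto simp: t)
  moreover have "\<nu> \<bullet> (barycenter t - x)
      = (\<nu> \<bullet> (z - x) + \<nu> \<bullet> (a - x) + \<nu> \<bullet> (b - x)) / 3"
    by (simp add: t inner_add_right inner_diff_right field_simps)
  ultimately have "\<forall>v\<in>verts t. \<nu> \<bullet> v \<le> \<nu> \<bullet> x"
    using neg by (auto simp: t inner_diff_right)
  from tri_subset_halfplane[OF this] y show False
    by (auto simp: inner_diff_right)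
qed

lemma noncollinearD:
  assumes "noncollinear t" "\<And>y. y \<in> verts t \<Longrightarrow> v \<bullet> y = c"
  shows "v = 0"
  using assms(1)[unfolded noncollinear_def, THEN spec[of _ v], THEN spec[of _ c]] assms(2) by simp

text \<open>If two vertices coincided, the functional \<open>perp (w - c)\<close> would be constant
  on all of them; if all three coincide, any nonzero functional will do.\<close>

lemma noncollinear_distinct:
  assumes "noncollinear t" "verts t = {w, c, d}"
  shows "c \<noteq> d"
proof
  assume "c = d"
  show False
  proof (cases "w = c")
    case True
    then have "axis 1 1 = (0::point)"
      using assms \<open>c = d\<close> by (intro noncollinearD[of t "axis 1 1" "axis 1 1 \<bullet> c"]) auto
    then show False by (simp add: axis_eq_0_iff)
  next
    case False
    have "perp (w - c) \<bullet> w = perp (w - c) \<bullet> c"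
      using perp_inner_self[of "w - c"] by (simp only: inner_diff_right right_minus_eq)
    then have "perp (w - c) = 0"
      using assms \<open>c = d\<close> by (intro noncollinearD[of t "perp (w - c)" "perp (w - c) \<bullet> c"]) auto
    with False show False by (simp add: perp_eq_0_iff)
  qed
qed

lemma noncollinear_simplex:
  assumes "2 simplex tri t"
  shows "noncollinear t"
  unfolding noncollinear_def
proof (intro allI impI, rule ccontr)
  fix v c
  assume *: "\<forall>y\<in>verts t. v \<bullet> y = c" and v: "v \<noteq> 0"
  have "tri t \<subseteq> {y. v \<bullet> y = c}"
    unfolding tri_eq_hull using * by (intro hull_minimal) (auto simp: convex_hyperplane)
  then have "aff_dim (tri t) \<le> aff_dim {y. v \<bullet> y = c}"
    by (rule aff_dim_subset)
  with v aff_dim_simplex[OF assms] show False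
    by (simp add: aff_dim_hyperplane)
qed

lemma simplex_interior_nonempty:
  assumes "2 simplex tri t"
  shows "interior (tri t) \<noteq> {}"
proof -
  have "affine hull tri t = UNIV"
    using aff_dim_simplex[OF assms] aff_dim_eq_full[of "tri t"] by simp
  moreover have "tri t \<noteq> {}"
    using barycenter_in_tri by blast
  ultimately show ?thesis
    by (metis convex_tri rel_interior_eq_empty rel_interior_interior)
qed

text \<open>The faces of a simplex are the hulls of subsets of its vertices. Containing a point that
  is no vertex rules out the empty set and singletons, and properness rules out all three
  vertices.\<close>

lemma proper_face_of_tri:
  assumes "2 simplex tri t" "G face_of tri t" "G \<noteq> tri t" "x \<in> G" "x \<notin> verts t"
  shows "G \<in> edges t"
proof -
  obtain z a b where t: "t = (z, a, b)"
    by (cases t)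
  obtain C where C: "\<not> affine_dependent C" "int (card C) = 2 + 1" "tri t = convex hull C"
    using assms(1) unfolding simplex_def by blast
  \<comment> \<open>The vertices of the abstract simplex are extreme points of the hull of
    \<open>verts t\<close>, hence members of it; counting then gives equality.\<close>
  have "C \<subseteq> verts t"
  proof
    fix y assume "y \<in> C"
    then have "y extreme_point_of (convex hull verts t)"
      using C extreme_point_of_convex_hull_affine_independent tri_eq_hull by metis
    then show "y \<in> verts t"
      by (rule extreme_point_of_convex_hull)
  qed
  moreover have "card (verts t) \<le> 3"
    by (simp add: t card_insert_if)
  moreover have "card C = 3"
    using C(2) by linarith
  ultimately have CV: "C = verts t"
    by (intro card_seteq) auto
  have "G face_of convex hull C"
    using assms(2) C(3) by metis
  then obtain c where "c \<subseteq> C" and G: "G = convex hull c"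
    using face_of_convex_hull_affine_independent[OF C(1), of G] by blast
  then have c: "c \<subseteq> {z, a, b}"
    by (simp add: CV t)
  have "c \<noteq> {z, a, b}" "c \<noteq> {}" "c \<noteq> {z}" "c \<noteq> {a}" "c \<noteq> {b}"
    using G assms(3-5) by (auto simp: t)
  then have "c = {z, a} \<or> c = {z, b} \<or> c = {a, b}"
    using c by blast
  then show ?thesis
    using G by (auto simp: t segment_convex_hull)
qed

text \<open>Expand \<open>\<nu>\<close> in the directions \<open>w - x\<close> and
  \<open>d - c\<close>. The barycentric coordinates of a point moved slightly from \<open>x\<close>
  along \<open>\<nu>\<close> are then positive: that of \<open>w\<close> grows from zero, those of
  \<open>c\<close> and \<open>d\<close> stay near \<open>1 - q\<close> and \<open>q\<close>.\<close>

lemma inner_normal_at_edge_points_into_tri: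
  assumes t: "noncollinear t" "verts t = {w, c, d}"
    and x: "x \<in> open_segment c d"
    and \<nu>: "norm \<nu> = 1" "\<nu> \<bullet> (d - c) = 0"
    and side: "\<forall>y\<in>tri t. 0 \<le> \<nu> \<bullet> (y - x)"
  shows "\<forall>\<^sub>F s in at_right 0. x + s *\<^sub>R \<nu> \<in> tri t"
proof -
  obtain q where q: "0 < q" "q < 1" "x = (1 - q) *\<^sub>R c + q *\<^sub>R d"
    using x by (auto simp: in_segment)
  define h where "h = \<nu> \<bullet> (w - x)"
  have eqs: "\<nu> \<bullet> d = \<nu> \<bullet> c" "\<nu> \<bullet> x = \<nu> \<bullet> c"
    using \<nu>(2) unfolding q(3) by (auto simp: inner_diff_right inner_add_right algebra_simps)
  have "h \<noteq> 0"
  proof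
    assume "h = 0"
    then have "\<nu> = 0"
      using t eqs by (intro noncollinearD[of t \<nu> "\<nu> \<bullet> c"]) (auto simp: h_def inner_diff_right)
    with \<nu>(1) show False by simp
  qed
  moreover have "0 \<le> h"
    using side verts_subset_tri[of t] t(2) by (auto simp: h_def)
  ultimately have h: "0 < h" by simp
  have cd: "d - c \<noteq> 0"
    using noncollinear_distinct[OF t] by simp
  \<comment> \<open>\<open>h\<close> is the height of \<open>w\<close> above the edge, so
    subtracting this multiple of \<open>w - x\<close> removes the component along
    \<open>\<nu>\<close>; what remains is parallel to the edge.\<close>
  define r where "r = \<nu> - (1 / h) *\<^sub>R (w - x)"
  have "\<nu> \<bullet> r = 0"
    using \<nu>(1) h by (simp add: r_def inner_diff_right norm_eq_1) (simp add: h_def inner_diff_right)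
  then have r: "r = (r \<bullet> perp \<nu>) *\<^sub>R perp \<nu>"
    by (rule perp_expansion) (rule \<nu>(1))
  have dc: "d - c = ((d - c) \<bullet> perp \<nu>) *\<^sub>R perp \<nu>"
    by (rule perp_expansion) (rule \<nu>)+
  define \<mu> where "\<mu> = (r \<bullet> perp \<nu>) / ((d - c) \<bullet> perp \<nu>)"
  have "(d - c) \<bullet> perp \<nu> \<noteq> 0"
    using dc cd by (metis scale_zero_left)
  then have "r = \<mu> *\<^sub>R (d - c)"
    using r dc by (metis \<mu>_def nonzero_eq_divide_eq scaleR_scaleR)
  then have \<nu>_eq: "\<nu> = (1 / h) *\<^sub>R (w - x) + \<mu> *\<^sub>R (d - c)"
    by (simp add: r_def algebra_simps)
  \<comment> \<open>The barycentric coordinates with respect to \<open>w\<close>, \<open>c\<close>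
    and \<open>d\<close>.\<close>
  have coords: "x + s *\<^sub>R \<nu> = (s / h) *\<^sub>R w + ((1 - q) * (1 - s / h) - s * \<mu>) *\<^sub>R c
      + (q * (1 - s / h) + s * \<mu>) *\<^sub>R d" for s
  proof -
    define \<sigma> where "\<sigma> = s / h"
    have "x + s *\<^sub>R \<nu> = x + \<sigma> *\<^sub>R (w - x) + (s * \<mu>) *\<^sub>R (d - c)"
      by (subst \<nu>_eq) (simp add: \<sigma>_def scaleR_add_right)
    also have "\<dots> = \<sigma> *\<^sub>R w + ((1 - q) * (1 - \<sigma>) - s * \<mu>) *\<^sub>R c
        + (q * (1 - \<sigma>) + s * \<mu>) *\<^sub>R d"
      unfolding q(3) by (simp add: algebra_simps)
    finally show ?thesis
      by (simp only: \<sigma>_def)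
  qed
  have "((\<lambda>s. (1 - q) * (1 - s / h) - s * \<mu>) \<longlongrightarrow> (1 - q) * (1 - 0 / h) - 0 * \<mu>) (at_right 0)"
    using h by (intro tendsto_intros) auto
  then have c_pos: "\<forall>\<^sub>F s in at_right 0. 0 < (1 - q) * (1 - s / h) - s * \<mu>"
    by (rule order_tendstoD) (use q in auto)
  have "((\<lambda>s. q * (1 - s / h) + s * \<mu>) \<longlongrightarrow> q * (1 - 0 / h) + 0 * \<mu>) (at_right 0)"
    using h by (intro tendsto_intros) auto
  then have d_pos: "\<forall>\<^sub>F s in at_right 0. 0 < q * (1 - s / h) + s * \<mu>"
    by (rule order_tendstoD) (use q in auto)
  show ?thesis
    using c_pos d_pos eventually_at_right_less[of "0::real"]
  proof eventually_elim
    case (elim s)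
    show ?case
      unfolding coords tri_eq_hull t(2) convex_hull_3
    proof (intro CollectI exI conjI)
      show "s / h + ((1 - q) * (1 - s / h) - s * \<mu>) + (q * (1 - s / h) + s * \<mu>) = 1"
        by (simp add: algebra_simps diff_divide_distrib)
    qed (use elim h in auto)
  qed
qed

section \<open>Bisection trees\<close>

text \<open>Bisection seen on single triangles. It puts a binary tree under each initial triangle,
  independent of the order in which a mesh is refined.\<close>

inductive child :: "ltri \<Rightarrow> ltri \<Rightarrow> bool" where
  "child (z, a, b) (midpoint a b, z, a)"
| "child (z, a, b) (midpoint a b, z, b)"

lemma refinement_ancestor:
  assumes "nvb_refines T T'" "s \<in> T'"
  shows "\<exists>t\<in>T. child\<^sup>*\<^sup>* t s"
  using assms unfolding nvb_refines_def
proof (induction arbitrary: s rule: rtranclp_induct)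
  case (step T' T'')
  from step.hyps(2) obtain z a b where z: "(z, a, b) \<in> T'"
    "T'' = T' - {(z, a, b)} \<union> {(midpoint a b, z, a), (midpoint a b, z, b)}"
    unfolding bisect_def by blast
  show ?case
  proof (cases "s \<in> T'")
    case False
    then have "child (z, a, b) s"
      using step.prems z(2) by (auto intro: child.intros)
    with step.IH[OF z(1)] show ?thesis
      by (meson rtranclp.rtrancl_into_rtrancl)
  qed (rule step.IH)
qed auto

lemma child_subset: "child t s \<Longrightarrow> tri s \<subseteq> tri t"
proof (induction rule: child.induct)
  have m: "midpoint a b \<in> convex hull {z, a, b}" for z a b :: point
  proof -
    have "midpoint a b \<in> convex hull {a, b}"
      by (metis midpoint_in_closed_segment segment_convex_hull)
    then show ?thesis
      by (meson hull_mono subsetD subset_insertI)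
  qed
  show "tri (midpoint a b, z, a) \<subseteq> tri (z, a, b)" "tri (midpoint a b, z, b) \<subseteq> tri (z, a, b)"
    for z a b
    using m[of a b z] unfolding tri.simps
    by (intro hull_minimal; auto simp: hull_inc)+
qed

lemma descendant_subset: "child\<^sup>*\<^sup>* t s \<Longrightarrow> tri s \<subseteq> tri t"
  by (induction rule: rtranclp_induct) (auto dest: child_subset)

text \<open>A functional with value \<open>c\<close> at the midpoint and at one end of the
  refinement edge has value \<open>c\<close> at the other end as well, so it is constant on the
  parent.\<close>

lemma noncollinear_child: "child t s \<Longrightarrow> noncollinear t \<Longrightarrow> noncollinear s"
proof (induction rule: child.induct)
  have "v = 0"
    if t: "noncollinear (z, a, b)" and "v \<bullet> midpoint a b = c" "v \<bullet> z = c" "v \<bullet> a = c \<or> v \<bullet> b = c"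
    for z a b v :: point and c
  proof (rule noncollinearD[OF t])
    have "2 * c = v \<bullet> a + v \<bullet> b"
      using that(2) by (simp add: midpoint_def inner_add_right)
    then show "v \<bullet> y = c" if "y \<in> verts (z, a, b)" for y
      using that \<open>v \<bullet> z = c\<close> \<open>v \<bullet> a = c \<or> v \<bullet> b = c\<close> by auto
  qed
  then show "noncollinear (midpoint a b, z, a)" "noncollinear (midpoint a b, z, b)"
    if "noncollinear (z, a, b)" for z a b
    using that unfolding noncollinear_def[of "(midpoint a b, z, a)"]
      noncollinear_def[of "(midpoint a b, z, b)"]
    by auto
qed

lemma noncollinear_descendant: "child\<^sup>*\<^sup>* t s \<Longrightarrow> noncollinear t \<Longrightarrow> noncollinear s"
  by (induction rule: rtranclp_induct) (auto dest: noncollinear_child)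

text \<open>The bisector through \<open>z\<close> and the midpoint separates the two
  children.\<close>

lemma distinct_children_interior_disjoint:
  assumes "child t s" "child t s'" "s \<noteq> s'" "noncollinear t"
  shows "interior (tri s) \<inter> tri s' = {}"
proof -
  have sep: "interior (tri (midpoint a b, z, a)) \<inter> tri (midpoint a b, z, b) = {}"
    if t: "noncollinear (z, a, b)" for z a b :: point
  proof -
    let ?m = "midpoint a b"
    \<comment> \<open>A normal of the bisector, with its sign chosen so that \<open>a\<close> lies
      on the nonnegative side; \<open>b\<close> is then on the opposite side, the midpoint being the
      average.\<close>
    define v where "v = (if perp (z - ?m) \<bullet> a \<ge> perp (z - ?m) \<bullet> ?m then 1 else - 1) *\<^sub>R perp (z - ?m)"
    have "z \<noteq> ?m"
      using noncollinear_distinct[of "(?m, z, a)" a ?m z] noncollinear_child[OF child.intros(1) t]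
      by (auto simp: insert_commute)
    then have v: "v \<noteq> 0"
      by (simp add: v_def perp_eq_0_iff)
    have "perp (z - ?m) \<bullet> z = perp (z - ?m) \<bullet> ?m"
      using perp_inner_self[of "z - ?m"] by (simp only: inner_diff_right right_minus_eq)
    then have vz: "v \<bullet> z = v \<bullet> ?m"
      by (simp add: v_def)
    have va: "v \<bullet> ?m \<le> v \<bullet> a"
      by (simp add: v_def)
    moreover have "v \<bullet> ?m = (v \<bullet> a + v \<bullet> b) / 2"
      by (simp add: midpoint_def inner_add_right)
    ultimately have vb: "v \<bullet> b \<le> v \<bullet> ?m"
      by simp
    have "\<forall>y\<in>tri (?m, z, a). (- v) \<bullet> y \<le> - (v \<bullet> ?m)"
      by (rule tri_subset_halfplane) (use va vz in auto)
    then have "tri (?m, z, a) \<subseteq> {y. v \<bullet> y \<ge> v \<bullet> ?m}"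
      by auto
    then have "interior (tri (?m, z, a)) \<subseteq> {y. v \<bullet> y > v \<bullet> ?m}"
      using interior_mono interior_halfspace_ge[OF v] by metis
    moreover have "\<forall>y\<in>tri (?m, z, b). v \<bullet> y \<le> v \<bullet> ?m"
      by (rule tri_subset_halfplane) (use vb vz in auto)
    ultimately show ?thesis
      by fastforce
  qed
  obtain z a b where t: "t = (z, a, b)"
    by (cases t)
  \<comment> \<open>Exchanging \<open>a\<close> and \<open>b\<close> reduces the second order of the
    children to the first.\<close>
  have swap: "noncollinear (z, b, a)"
    using assms(4) by (auto simp: t noncollinear_def insert_commute)
  from assms(1-3) consider "s = (midpoint a b, z, a)" "s' = (midpoint a b, z, b)"
    | "s = (midpoint b a, z, b)" "s' = (midpoint b a, z, a)"
    by (auto simp: t child.simps midpoint_sym)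
  then show ?thesis
    by cases (use sep assms(4) swap t in blast)+
qed

text \<open>Follow the path from \<open>r\<close> down to \<open>t\<close>. As long as the path to
  \<open>u\<close> takes the same child, induction applies; where the paths part, the triangles lie
  in distinct children.\<close>

lemma same_tree_nested_or_disjoint:
  assumes "child\<^sup>*\<^sup>* r t" "child\<^sup>*\<^sup>* r u" "noncollinear r"
  shows "child\<^sup>*\<^sup>* t u \<or> child\<^sup>*\<^sup>* u t \<or> interior (tri t) \<inter> tri u = {}"
  using assms
proof (induction rule: converse_rtranclp_induct)
  case (step r r')
  from step.prems(1) show ?case
  proof (cases rule: converse_rtranclpE)
    case base
    then show ?thesis
      using step.hyps by (meson converse_rtranclp_into_rtranclp)
  next
    case (step r'')
    show ?thesis
    proof (cases "r' = r''")
      case True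
      then show ?thesis
        using step step.IH noncollinear_child \<open>child r r'\<close> \<open>noncollinear r\<close> by blast
    next
      case False
      then have "interior (tri r') \<inter> tri r'' = {}"
        using distinct_children_interior_disjoint \<open>child r r'\<close> step(1) \<open>noncollinear r\<close> by blast
      moreover have "interior (tri t) \<subseteq> interior (tri r')"
        using interior_mono descendant_subset \<open>child\<^sup>*\<^sup>* r' t\<close> by blast
      ultimately show ?thesis
        using descendant_subset[OF step(2)] by blast
    qed
  qed
qed auto

section \<open>Coarse triangles around a fine vertex or edge\<close>

lemma conforming_simplex: "conforming_mesh \<Omega> T \<Longrightarrow> t \<in> T \<Longrightarrow> 2 simplex tri t"
  by (simp add: conforming_mesh_def)

text \<open>If \<open>t\<close> were contained in \<open>t'\<close>, it would be a proper face of
  \<open>t'\<close> and miss the interior of \<open>t'\<close>; but the nonempty interior of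
  \<open>t\<close> lies in that interior.\<close>

lemma conforming_meet:
  assumes T: "conforming_mesh \<Omega> T" and t: "t \<in> T" "t' \<in> T" "t \<noteq> t'"
  shows "tri t \<inter> tri t' face_of tri t" "tri t \<inter> tri t' \<noteq> tri t"
proof -
  have ne: "tri t \<noteq> tri t'"
    using T t unfolding conforming_mesh_def by (meson inj_onD)
  have "\<forall>S S'. S \<in> tri ` T \<and> S' \<in> tri ` T \<longrightarrow> (S \<inter> S') face_of S"
    using T unfolding conforming_mesh_def triangulation_def by blast
  then have face: "tri t \<inter> tri t' face_of tri t" "tri t' \<inter> tri t face_of tri t'"
    using t by simp_all
  show "tri t \<inter> tri t' face_of tri t"
    by (rule face)
  show "tri t \<inter> tri t' \<noteq> tri t"
  proof
    assume "tri t \<inter> tri t' = tri t"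
    then have sub: "tri t \<subseteq> tri t'"
      by blast
    then have "tri t \<inter> interior (tri t') = {}"
      using face_of_disjoint_interior[OF face(2)] ne by (simp add: Int_absorb1)
    moreover have "interior (tri t) \<noteq> {}"
      using T t by (intro simplex_interior_nonempty conforming_simplex)
    ultimately show False
      using interior_mono[OF sub] interior_subset[of "tri t"] by blast
  qed
qed

lemma conforming_interior_disjoint:
  assumes "conforming_mesh \<Omega> T" "t \<in> T" "t' \<in> T" "t \<noteq> t'"
  shows "interior (tri t) \<inter> tri t' = {}"
  using face_of_disjoint_interior[OF conforming_meet[OF assms]] interior_subset[of "tri t"] by blast

section \<open>Edges of the bisection forest and their normals\<close>

lemma forest_ancestor:
  assumes "u \<in> forest T0"
  obtains r where "r \<in> T0" "child\<^sup>*\<^sup>* r u"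
  using assms refinement_ancestor unfolding forest_def by blast

lemma forest_noncollinear:
  assumes "conforming_mesh \<Omega> T0" "u \<in> forest T0"
  shows "noncollinear u"
  using assms(2)
proof (rule forest_ancestor)
  fix r assume "r \<in> T0" "child\<^sup>*\<^sup>* r u"
  then show ?thesis
    using assms(1) by (blast intro: noncollinear_descendant noncollinear_simplex conforming_simplex)
qed

text \<open>Let \<open>u\<close> carry the edge. If \<open>u\<close> descends from \<open>t\<close>,
  an edge meeting the interior of \<open>t\<close> would have its midpoint there. If
  \<open>t\<close> descends from \<open>u\<close>, the interior of \<open>t\<close> lies in that of
  \<open>u\<close>, which no edge of \<open>u\<close> meets. Otherwise the interior of
  \<open>t\<close> misses \<open>u\<close> altogether.\<close>

lemma forest_edge_avoids_interior:
  assumes T0: "conforming_mesh \<Omega> T0" and "t \<in> forest T0" "u \<in> forest T0"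
    and e: "closed_segment a b \<in> edges u" and x: "midpoint a b \<notin> interior (tri t)"
  shows "interior (tri t) \<inter> closed_segment a b = {}"
proof -
  obtain r r' where r: "r \<in> T0" "child\<^sup>*\<^sup>* r t" and r': "r' \<in> T0" "child\<^sup>*\<^sup>* r' u"
    using assms(2,3) by (metis forest_ancestor)
  have e_sub: "closed_segment a b \<subseteq> tri u"
    using e by (rule edge_subset_tri)
  consider "r \<noteq> r'" | "child\<^sup>*\<^sup>* t u" | "child\<^sup>*\<^sup>* u t" | "interior (tri t) \<inter> tri u = {}"
    using same_tree_nested_or_disjoint[OF r(2)] r' noncollinear_simplex[OF conforming_simplex[OF T0 r(1)]]
    by blast
  then show ?thesis
  proof cases
    case 1
    then have "interior (tri r) \<inter> tri r' = {}"
      using conforming_interior_disjoint T0 r(1) r'(1) by blast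
    then show ?thesis
      using e_sub interior_mono[OF descendant_subset[OF r(2)]] descendant_subset[OF r'(2)] by blast
  next
    case 2
    then show ?thesis
      using midpoint_in_interior_if_segment_meets_interior[of "tri t" a b] e_sub descendant_subset x
      by (meson convex_tri subset_trans)
  next
    case 3
    have "interior (tri u) \<inter> closed_segment a b = {}"
    proof -
      obtain w c d where eq: "closed_segment a b = closed_segment c d" and u: "verts u = {w, c, d}"
        using e by (rule edge_cases)
      \<comment> \<open>A normal of the edge pointing away from the opposite vertex
        \<open>w\<close>: the triangle lies in a half-plane whose boundary line carries the
        edge.\<close>
      let ?v = "(if perp (d - c) \<bullet> w \<le> perp (d - c) \<bullet> c then 1 else - 1) *\<^sub>R perp (d - c)"
      have "c \<noteq> d"
        using noncollinear_distinct[OF forest_noncollinear[OF T0 assms(3)] u] .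
      then have v: "?v \<noteq> 0"
        by (simp add: perp_eq_0_iff)
      have "perp (d - c) \<bullet> d = perp (d - c) \<bullet> c"
        using perp_inner_self[of "d - c"] by (simp only: inner_diff_right right_minus_eq)
      then have vd: "?v \<bullet> d = ?v \<bullet> c"
        by simp
      have "\<forall>y\<in>tri u. ?v \<bullet> y \<le> ?v \<bullet> c"
        by (rule tri_subset_halfplane) (use vd in \<open>auto simp: u\<close>)
      then have "tri u \<subseteq> {y. ?v \<bullet> y \<le> ?v \<bullet> c}"
        by blast
      then have "interior (tri u) \<subseteq> {y. ?v \<bullet> y < ?v \<bullet> c}"
        using interior_mono interior_halfspace_le[OF v] by metis
      moreover have "closed_segment c d \<subseteq> {y. ?v \<bullet> y = ?v \<bullet> c}"
        unfolding segment_convex_hull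
        by (intro hull_minimal convex_hyperplane) (use vd in auto)
      ultimately show ?thesis
        unfolding eq by fastforce
    qed
    then show ?thesis
      using interior_mono[OF descendant_subset[OF 3]] by blast
  next
    case 4
    then show ?thesis
      using e_sub by blast
  qed
qed

lemma edge_normal:
  assumes "edge_normals \<Omega> T0 n" "t \<in> forest T0" "e \<in> edges t"
  shows "norm (n e) = 1" "\<lbrakk>x \<in> e; y \<in> e\<rbrakk> \<Longrightarrow> n e \<bullet> (x - y) = 0"
    "\<lbrakk>e \<subseteq> frontier \<Omega>; x \<in> rel_interior e\<rbrakk> \<Longrightarrow> \<forall>\<^sub>F s in at_right 0. x + s *\<^sub>R n e \<notin> closure \<Omega>"
  using assms unfolding edge_normals_def by (fastforce elim: eventually_mono)+

lemma creating_edge_obtain: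
  assumes "conforming_mesh \<Omega> T0" "e \<in> creating_edges T0 x"
  obtains u a b where "u \<in> forest T0" "e \<in> edges u" "e = closed_segment a b" "x = midpoint a b" "a \<noteq> b"
proof -
  obtain z a b where e: "e = closed_segment a b" "(z, a, b) \<in> forest T0" "midpoint a b = x"
    using assms(2) unfolding creating_edges_def by blast
  show thesis
  proof (rule that[OF e(2)])
    show "a \<noteq> b"
      by (rule noncollinear_distinct[OF forest_noncollinear[OF assms(1) e(2)], of z]) simp
  qed (use e in auto)
qed

text \<open>Both are unit vectors orthogonal to the direction of \<open>e\<close>. The sign remains
  open because the normals of \<open>e\<close> and \<open>f\<close> are chosen separately.\<close>

lemma normals_of_nested_edges:
  assumes "edge_normals \<Omega> T0 n" "t \<in> forest T0" "u \<in> forest T0" "noncollinear u"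
    and "f \<in> edges t" "e \<in> edges u" "e \<subseteq> f"
  shows "n e = n f \<or> n e = - n f"
  using assms(6)
proof (rule edge_cases)
  fix w c d assume e: "e = closed_segment c d" and u: "verts u = {w, c, d}"
  then have "c \<noteq> d"
    using noncollinear_distinct assms(4) by blast
  moreover have "n e \<bullet> (c - d) = 0"
    by (rule edge_normal[OF assms(1,3,6)]) (use e in auto)
  moreover have "n f \<bullet> (c - d) = 0"
    by (rule edge_normal[OF assms(1,2,5)]) (use e assms(7) in auto)
  ultimately show ?thesis
    using unit_normals_eq_up_to_sign[of "c - d"] edge_normal(1)[OF assms(1,3,6)]
      edge_normal(1)[OF assms(1,2,5)] by simp
qed

text \<open>The edge \<open>e\<close> avoids the interior of \<open>t\<close> while its midpoint
  \<open>x\<close> belongs to \<open>t\<close>, so the line through \<open>e\<close> supports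
  \<open>t\<close>. Thus the two sides of \<open>e\<close> at \<open>x\<close> are meaningful for
  \<open>t\<close>, even when \<open>t\<close> is much larger than \<open>e\<close>.\<close>

lemma tri_on_one_side_of_creating_edge:
  assumes "conforming_mesh \<Omega> T0" "edge_normals \<Omega> T0 n" "t \<in> forest T0" "2 simplex tri t"
    and "e \<in> creating_edges T0 x" "x \<in> tri t" "x \<notin> interior (tri t)"
  shows "(\<forall>y\<in>tri t. 0 \<le> n e \<bullet> (y - x)) \<or> (\<forall>y\<in>tri t. n e \<bullet> (y - x) \<le> 0)"
  using assms(1,5)
proof (rule creating_edge_obtain)
  fix u a b
  assume u: "u \<in> forest T0" "e \<in> edges u" "e = closed_segment a b" "x = midpoint a b" "a \<noteq> b"
  have int: "interior (tri t) \<noteq> {}"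
    by (rule simplex_interior_nonempty) (rule assms)
  have "tri t \<subseteq> closure (interior (tri t))"
    using convex_closure_interior[OF convex_tri int] closure_subset[of "tri t"] by simp
  moreover have "interior (tri t) \<inter> closed_segment a b = {}"
    by (rule forest_edge_avoids_interior) (use assms u in auto)
  moreover have "n e \<bullet> (a - b) = 0"
    by (rule edge_normal[OF assms(2) u(1,2)]) (use u in auto)
  ultimately show ?thesis
    unfolding u(4) using assms(6) u int edge_normal(1)[OF assms(2) u(1,2)]
    by (intro one_side_of_segment) auto
qed

text \<open>As \<open>x\<close> is no vertex of the mesh, the common face of \<open>t\<close> and
  \<open>t'\<close> is an edge \<open>f\<close> with \<open>x\<close> in its relative interior. The
  line through \<open>e\<close> supports \<open>t\<close> at \<open>x\<close>, hence contains
  \<open>f\<close>, and the two triangles lie on opposite sides of it.\<close>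

lemma coarse_pair_at_interior_edge_point:
  assumes T0: "conforming_mesh \<Omega> T0" and n: "edge_normals \<Omega> T0 n"
    and T: "conforming_mesh \<Omega> T" "T \<subseteq> forest T0"
    and t: "t \<in> T" "t' \<in> T" "t \<noteq> t'" "x \<in> tri t" "x \<in> tri t'"
    and x: "x \<notin> mesh_verts T" and e: "e \<in> creating_edges T0 x"
  obtains f where "f \<in> interior_edges \<Omega> T" "f \<in> edges t" "f \<in> edges t'" "x \<in> f"
    "n e = n f \<or> n e = - n f"
    "\<And>\<nu>. \<nu> = n e \<or> \<nu> = - n e \<Longrightarrow>
       \<not> ((\<forall>y\<in>tri t. 0 \<le> \<nu> \<bullet> (y - x)) \<and> (\<forall>y\<in>tri t'. 0 \<le> \<nu> \<bullet> (y - x)))"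
proof -
  define f where "f = tri t \<inter> tri t'"
  have xv: "x \<notin> verts t" "x \<notin> verts t'"
    using x t unfolding mesh_verts_def by blast+
  have xf: "x \<in> f"
    using t by (simp add: f_def)
  have f: "f \<in> edges t" "f \<in> edges t'"
    using proper_face_of_tri[OF conforming_simplex[OF T(1)] conforming_meet[OF T(1)], of t t' x]
      proper_face_of_tri[OF conforming_simplex[OF T(1)] conforming_meet[OF T(1)], of t' t x] t xv
    by (auto simp: f_def Int_commute)
  have forest: "t \<in> forest T0" "t' \<in> forest T0"
    using t T(2) by auto
  note nf = edge_normal[OF n forest(1) f(1)]
  have nc: "noncollinear t" "noncollinear t'"
    using forest_noncollinear[OF T0] forest by auto
  obtain w c d where fcd: "f = closed_segment c d" and vt: "verts t = {w, c, d}"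
    using f(1) by (rule edge_cases)
  obtain w' c' d' where fcd': "f = closed_segment c' d'" and vt': "verts t' = {w', c', d'}"
    using f(2) by (rule edge_cases)
  have x_open: "x \<in> open_segment c d" "x \<in> open_segment c' d'"
    using xf xv unfolding vt vt' open_segment_def by (auto simp flip: fcd fcd')
  have cd: "c \<noteq> d"
    using noncollinear_distinct[OF nc(1) vt] .
  have disj: "tri t \<inter> tri t' \<inter> interior (tri t) = {}" "tri t \<inter> tri t' \<inter> interior (tri t') = {}"
    using conforming_interior_disjoint[OF T(1) t(1,2)] conforming_interior_disjoint[OF T(1) t(2,1)] t(3)
    by auto
  have side: "(\<forall>y\<in>tri s. 0 \<le> n e \<bullet> (y - x)) \<or> (\<forall>y\<in>tri s. n e \<bullet> (y - x) \<le> 0)"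
    if "s \<in> {t, t'}" for s
  proof (rule tri_on_one_side_of_creating_edge[OF T0 n _ _ e])
    show "2 simplex tri s"
      using that t by (intro conforming_simplex[OF T(1)]) auto
  qed (use that t forest disj in auto)
  have norm_e: "norm (n e) = 1"
    using T0 e by (rule creating_edge_obtain) (rule edge_normal(1)[OF n])
  obtain q where q: "0 < q" "q < 1" "x = (1 - q) *\<^sub>R c + q *\<^sub>R d"
    using x_open(1) by (auto simp: in_segment)
  \<comment> \<open>The heights of \<open>c\<close> and \<open>d\<close> over the line through
    \<open>e\<close> have a vanishing combination with positive weights, and they do not have
    opposite signs because \<open>t\<close> lies on one side; so both are zero.\<close>
  have "(1 - q) * (n e \<bullet> (c - x)) + q * (n e \<bullet> (d - x)) = 0"
    unfolding q(3) by (simp add: inner_diff_right inner_add_right algebra_simps)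
  moreover have "0 \<le> n e \<bullet> (c - x) \<and> 0 \<le> n e \<bullet> (d - x) \<or> n e \<bullet> (c - x) \<le> 0 \<and> n e \<bullet> (d - x) \<le> 0"
    using side[of t] verts_subset_tri[of t] unfolding vt by auto
  ultimately have "n e \<bullet> (c - x) = 0 \<and> n e \<bullet> (d - x) = 0"
    using q(1,2) by (smt (verit) mult_pos_pos mult_pos_neg mult_nonneg_nonneg mult_nonneg_nonpos)
  then have "n e \<bullet> (c - d) = 0"
    by (simp add: inner_diff_right)
  moreover have "n f \<bullet> (c - d) = 0"
    by (rule nf(2)) (auto simp: fcd)
  ultimately have ef: "n e = n f \<or> n e = - n f"
    using unit_normals_eq_up_to_sign[of "c - d"] cd norm_e nf(1) by simp
  have into: "\<forall>\<^sub>F s in at_right 0. x + s *\<^sub>R \<nu> \<in> tri r"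
    if \<nu>: "\<nu> = n f \<or> \<nu> = - n f" and r: "r \<in> {t, t'}" and "\<forall>y\<in>tri r. 0 \<le> \<nu> \<bullet> (y - x)" for \<nu> r
  proof -
    have "norm \<nu> = 1" "\<nu> \<bullet> (d - c) = 0" "\<nu> \<bullet> (d' - c') = 0"
      using \<nu> nf(1) nf(2)[of d c] nf(2)[of d' c'] by (auto simp: fcd) (auto simp: fcd' simp flip: fcd)
    then show ?thesis
      using that inner_normal_at_edge_points_into_tri[OF nc(1) vt x_open(1)]
        inner_normal_at_edge_points_into_tri[OF nc(2) vt' x_open(2)] by auto
  qed
  \<comment> \<open>If both triangles were on the side of \<open>\<nu>\<close>, a short step from
    \<open>x\<close> along \<open>\<nu>\<close> would stay in both, hence in \<open>f\<close>,
    although \<open>\<nu>\<close> is normal to \<open>f\<close>.\<close>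
  have opposite: False
    if \<nu>: "\<nu> = n f \<or> \<nu> = - n f"
      and "\<forall>y\<in>tri t. 0 \<le> \<nu> \<bullet> (y - x)" "\<forall>y\<in>tri t'. 0 \<le> \<nu> \<bullet> (y - x)" for \<nu>
  proof -
    have "\<forall>\<^sub>F s in at_right (0::real). 0 < s \<and> x + s *\<^sub>R \<nu> \<in> f"
      using into[OF \<nu> _ that(2)] into[OF \<nu> _ that(3)] eventually_at_right_less[of "0::real"]
      by (auto simp: f_def elim: eventually_elim2 intro: eventually_conj)
    then obtain s where s: "0 < (s::real)" "x + s *\<^sub>R \<nu> \<in> f"
      using eventually_happens'[OF trivial_limit_at_right_real] by blast
    have "n f \<bullet> (x + s *\<^sub>R \<nu> - x) = 0"
      by (rule nf(2)) (use s xf in auto)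
    then have "n f \<bullet> \<nu> = 0"
      using s by simp
    then show False
      using \<nu> nf(1) by (auto simp: norm_eq_1)
  qed
  have "\<not> f \<subseteq> frontier \<Omega>"
  proof
    assume fr: "f \<subseteq> frontier \<Omega>"
    have "x \<in> rel_interior f"
      using x_open(1) cd by (simp add: fcd rel_interior_closed_segment)
    note out = nf(3)[OF fr this]
    \<comment> \<open>The triangles are not both on the side of \<open>- n f\<close>. The one on the
      side of \<open>n f\<close> contains points just beyond \<open>x\<close> in that direction,
      whereas an outward normal would leave the closure of the domain.\<close>
    have "\<exists>r\<in>{t, t'}. \<forall>y\<in>tri r. 0 \<le> n f \<bullet> (y - x)"
      using side[of t] side[of t'] ef opposite[of "- n f"] by fastforce
    then obtain r where r: "r \<in> {t, t'}" "\<forall>y\<in>tri r. 0 \<le> n f \<bullet> (y - x)"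
      by blast
    have "tri r \<subseteq> closure \<Omega>"
      using T(1) r(1) t(1,2) unfolding conforming_mesh_def by blast
    with into[of "n f" r] r have "\<forall>\<^sub>F s in at_right (0::real). x + s *\<^sub>R n f \<in> closure \<Omega>"
      by (auto elim!: eventually_mono)
    with out have "\<forall>\<^sub>F s in at_right (0::real). False"
      by eventually_elim simp
    then show False
      using eventually_happens'[OF trivial_limit_at_right_real] by blast
  qed
  then have "f \<in> interior_edges \<Omega> T"
    using f t unfolding interior_edges_def by blast
  moreover have "\<not> ((\<forall>y\<in>tri t. 0 \<le> \<nu> \<bullet> (y - x)) \<and> (\<forall>y\<in>tri t'. 0 \<le> \<nu> \<bullet> (y - x)))"
    if "\<nu> = n e \<or> \<nu> = - n e" for \<nu>
  proof -
    have "\<nu> = n f \<or> \<nu> = - n f"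
      using that ef by auto
    then show ?thesis
      using opposite by blast
  qed
  ultimately show thesis
    using that[of f] f xf ef by blast
qed

text \<open>The edge \<open>e\<close> has infinitely many points, so one of them is a vertex of
  neither triangle. The common face through it is then a full edge, and it contains
  \<open>e\<close>.\<close>

lemma coarse_pair_at_fine_edge:
  assumes T: "conforming_mesh \<Omega> T"
    and t: "t \<in> T" "t' \<in> T" "t \<noteq> t'" "e \<subseteq> tri t" "e \<subseteq> tri t'"
    and e: "\<not> e \<subseteq> frontier \<Omega>" "e \<in> edges u" "noncollinear u"
  obtains f where "f \<in> interior_edges \<Omega> T" "f \<in> edges t" "f \<in> edges t'" "e \<subseteq> f"
  using e(2)
proof (rule edge_cases)
  fix w c d assume cd: "e = closed_segment c d" and u: "verts u = {w, c, d}"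
  have "infinite (closed_segment c d)"
    using noncollinear_distinct[OF e(3) u] uncountable_closed_segment uncountable_infinite by blast
  then have "infinite (e - (verts t \<union> verts t'))"
    unfolding cd by (intro Diff_infinite_finite) auto
  then obtain x where x: "x \<in> e" "x \<notin> verts t" "x \<notin> verts t'"
    using infinite_imp_nonempty by blast
  let ?f = "tri t \<inter> tri t'"
  have "?f \<in> edges t" "?f \<in> edges t'"
    using proper_face_of_tri[OF conforming_simplex[OF T] conforming_meet[OF T], of t t' x]
      proper_face_of_tri[OF conforming_simplex[OF T] conforming_meet[OF T], of t' t x] t x
    by (auto simp: Int_commute)
  moreover have "e \<subseteq> ?f"
    using t by blast
  ultimately show thesis
    using that[of ?f] e(1) t(1) unfolding interior_edges_def by blast
qed

section \<open>Transfer of the conditions to the refined mesh\<close>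

lemma traces_agree_atD:
  "\<lbrakk>traces_agree_at P x q; t \<in> P; t' \<in> P; x \<in> tri t; x \<in> tri t'\<rbrakk> \<Longrightarrow> q t x = q t' x"
  unfolding traces_agree_at_def by blast

lemma jump_vanishesD:
  "\<lbrakk>jump_vanishes T e q; t \<in> T; t' \<in> T; e \<in> edges t; e \<in> edges t'; x \<in> e\<rbrakk> \<Longrightarrow> q t x = q t' x"
  unfolding jump_vanishes_def by blast

lemma matrix_vector_mult_uminus_right: "A *v (- v) = - (A *v v)" for A :: "real^'n^'m"
  using matrix_vector_mul_linear linear_neg by blast

theorem theorem5p1:
  fixes \<Omega> :: "(real^2) set"
    and T0 TH Th :: mesh
    and n :: "(real^2) set \<Rightarrow> real^2"
    and k :: nat
  assumes "lipschitz_domain \<Omega>" and "polygonal \<Omega>" and "bounded \<Omega>" and "simply_connected \<Omega>"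
    and "conforming_mesh \<Omega> T0"
    and "edge_normals \<Omega> T0 n"
    and "k \<ge> 3"
    and "TH \<in> admissible \<Omega> T0" and "Th \<in> admissible \<Omega> T0"
    and "nvb_refines TH Th"
  shows "ext_moment_space \<Omega> T0 n k TH \<subseteq> ext_moment_space \<Omega> T0 n k Th"
proof
  fix \<tau> assume "\<tau> \<in> ext_moment_space \<Omega> T0 n k TH"
  then obtain p where \<tau>: "\<tau> \<in> Hdivdiv \<Omega>"
    and poly: "\<And>t. t \<in> TH \<Longrightarrow> p t \<in> poly_sym k"
    and ae: "\<And>t. t \<in> TH \<Longrightarrow> AE x in lebesgue_on (tri t). \<tau> x = p t x"
    and old: "\<And>x. x \<in> mesh_verts T0 \<Longrightarrow> traces_agree_at TH x p"
    and tt_plus: "\<And>x e. \<lbrakk>x \<in> mesh_verts TH - mesh_verts T0; e \<in> creating_edges T0 x\<rbrakk> \<Longrightarrow>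
      traces_agree_at (side_patch TH x (n e)) x (\<lambda>t y. perp (n e) \<bullet> (p t y *v perp (n e)))"
    and tt_minus: "\<And>x e. \<lbrakk>x \<in> mesh_verts TH - mesh_verts T0; e \<in> creating_edges T0 x\<rbrakk> \<Longrightarrow>
      traces_agree_at (side_patch TH x (- n e)) x (\<lambda>t y. perp (n e) \<bullet> (p t y *v perp (n e)))"
    and normal: "\<And>x e. \<lbrakk>x \<in> mesh_verts TH - mesh_verts T0; e \<in> creating_edges T0 x\<rbrakk> \<Longrightarrow>
      traces_agree_at TH x (\<lambda>t y. p t y *v n e)"
    and jump: "\<And>e. e \<in> interior_edges \<Omega> TH \<Longrightarrow> jump_vanishes TH e (\<lambda>t y. p t y *v n e)"
    and jump_div: "\<And>e. e \<in> interior_edges \<Omega> TH \<Longrightarrow>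
      jump_vanishes TH e (\<lambda>t y. n e \<bullet> row_div (p t) y)"
    unfolding ext_moment_space_def by blast
  have TH: "conforming_mesh \<Omega> TH" "TH \<subseteq> forest T0"
    and Th: "conforming_mesh \<Omega> Th" "Th \<subseteq> forest T0"
    using assms(8,9) unfolding admissible_def forest_def by auto
  \<comment> \<open>\<open>A\<close> selects the coarse ancestor of each fine triangle;
    \<open>p (A s)\<close> will be the polynomial on \<open>s\<close>.\<close>
  obtain A where A: "\<And>s. s \<in> Th \<Longrightarrow> A s \<in> TH" "\<And>s. s \<in> Th \<Longrightarrow> child\<^sup>*\<^sup>* (A s) s"
    using refinement_ancestor[OF assms(10)] by metis
  have sub: "tri s \<subseteq> tri (A s)" if "s \<in> Th" for s
    using A(2)[OF that] by (rule descendant_subset)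
  have ae_fine: "AE x in lebesgue_on (tri s). \<tau> x = p (A s) x" if "s \<in> Th" for s
  proof -
    have "AE x in lebesgue. x \<in> tri (A s) \<longrightarrow> \<tau> x = p (A s) x"
      using ae[OF A(1)[OF that]] by (simp add: AE_restrict_space_iff)
    then show ?thesis
      using sub[OF that] by (auto simp: AE_restrict_space_iff elim: eventually_mono)
  qed
  \<comment> \<open>Lifts membership in a fine side patch to the coarse ancestor. A second ancestor
    through \<open>x\<close> puts \<open>x\<close> on the boundary of \<open>A s\<close>, so
    \<open>A s\<close> lies on one side of \<open>e\<close>; the barycenter of \<open>s\<close>, a
    point of \<open>A s\<close>, decides which side.\<close>
  have coarse_side: "\<forall>y\<in>tri (A s). 0 \<le> \<nu> \<bullet> (y - x)" "A s \<in> side_patch TH x \<nu>"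
    if e: "e \<in> creating_edges T0 x" and \<nu>: "\<nu> = n e \<or> \<nu> = - n e" and s: "s \<in> side_patch Th x \<nu>"
      and s': "s' \<in> Th" "x \<in> tri s'" "A s \<noteq> A s'" for e x \<nu> s s'
  proof -
    have s: "s \<in> Th" "x \<in> tri s" "0 < \<nu> \<bullet> (barycenter s - x)"
      using s by (auto simp: side_patch_def inner_commute)
    have bary: "barycenter s \<in> tri (A s)"
      using barycenter_in_tri sub[OF s(1)] by blast
    have "interior (tri (A s)) \<inter> tri (A s') = {}"
      using conforming_interior_disjoint[OF TH(1) A(1)[OF s(1)] A(1)[OF s'(1)] s'(3)] .
    then have "x \<notin> interior (tri (A s))"
      using sub s' by blast
    then have "(\<forall>y\<in>tri (A s). 0 \<le> n e \<bullet> (y - x)) \<or> (\<forall>y\<in>tri (A s). n e \<bullet> (y - x) \<le> 0)"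
      using sub[OF s(1)] s A(1)[OF s(1)] TH(2)
      by (intro tri_on_one_side_of_creating_edge[OF assms(5,6) _ conforming_simplex[OF TH(1)] e]) auto
    then show side: "\<forall>y\<in>tri (A s). 0 \<le> \<nu> \<bullet> (y - x)"
      using bary s(3) \<nu> by fastforce
    show "A s \<in> side_patch TH x \<nu>"
      using barycenter_strictly_on_side[OF bary s(3) side] A(1)[OF s(1)] sub[OF s(1)] s(2)
      by (auto simp: side_patch_def inner_commute)
  qed
  have tt_fine: "traces_agree_at (side_patch Th x \<nu>) x (\<lambda>s y. perp (n e) \<bullet> (p (A s) y *v perp (n e)))"
    if x: "x \<notin> mesh_verts T0" and e: "e \<in> creating_edges T0 x" and \<nu>: "\<nu> = n e \<or> \<nu> = - n e"
    for x e \<nu>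
    unfolding traces_agree_at_def
  proof (intro ballI impI)
    fix s s' assume s: "s \<in> side_patch Th x \<nu>" "s' \<in> side_patch Th x \<nu>" "x \<in> tri s" "x \<in> tri s'"
    then have Th_s: "s \<in> Th" "s' \<in> Th"
      by (auto simp: side_patch_def)
    have xA: "x \<in> tri (A s)" "x \<in> tri (A s')"
      using sub Th_s s by blast+
    show "perp (n e) \<bullet> (p (A s) x *v perp (n e)) = perp (n e) \<bullet> (p (A s') x *v perp (n e))"
    proof (cases "A s = A s'")
      case False
      note side = coarse_side[OF e \<nu> s(1) Th_s(2) s(4) False]
        coarse_side[OF e \<nu> s(2) Th_s(1) s(3) not_sym[OF False]]
      \<comment> \<open>At a point that is no coarse vertex, two distinct ancestors would lie on
        opposite sides of \<open>e\<close>, but here both are on the side of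
        \<open>\<nu>\<close>.\<close>
      have "x \<in> mesh_verts TH"
      proof (rule ccontr)
        assume "x \<notin> mesh_verts TH"
        from coarse_pair_at_interior_edge_point[OF assms(5,6) TH A(1)[OF Th_s(1)] A(1)[OF Th_s(2)]
            False xA this e]
        show False
          using side(1,3) \<nu> by metis
      qed
      then show ?thesis
        using traces_agree_atD[OF tt_plus[of x e] _ _ xA] traces_agree_atD[OF tt_minus[of x e] _ _ xA]
          side(2,4) \<nu> x e by auto
    qed simp
  qed
  have normal_fine: "traces_agree_at Th x (\<lambda>s y. p (A s) y *v n e)"
    if x: "x \<notin> mesh_verts T0" and e: "e \<in> creating_edges T0 x" for x e
    unfolding traces_agree_at_def
  proof (intro ballI impI)
    fix s s' assume s: "s \<in> Th" "s' \<in> Th" "x \<in> tri s" "x \<in> tri s'"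
    have xA: "x \<in> tri (A s)" "x \<in> tri (A s')"
      using sub s by blast+
    consider "A s = A s'" | "x \<in> mesh_verts TH" | "A s \<noteq> A s'" "x \<notin> mesh_verts TH"
      by blast
    then show "p (A s) x *v n e = p (A s') x *v n e"
    proof cases
      case 2
      then show ?thesis
        using traces_agree_atD[OF normal[of x e] _ _ xA] A(1) s x e by auto
    next
      case 3
      from coarse_pair_at_interior_edge_point[OF assms(5,6) TH A(1)[OF s(1)] A(1)[OF s(2)] 3(1) xA 3(2) e]
      obtain f where f: "f \<in> interior_edges \<Omega> TH" "f \<in> edges (A s)" "f \<in> edges (A s')" "x \<in> f"
        and nf: "n e = n f \<or> n e = - n f"
        by metis
      \<comment> \<open>Away from coarse vertices, continuity of the normal trace at
        \<open>x\<close> comes from the vanishing jump across the coarse edge \<open>f\<close>, and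
        a change of sign of the normal preserves the equality.\<close>
      have "p (A s) x *v n f = p (A s') x *v n f"
        using jump_vanishesD[OF jump[OF f(1)] A(1)[OF s(1)] A(1)[OF s(2)] f(2-4)] .
      then show ?thesis
        using nf by (auto simp: matrix_vector_mult_uminus_right)
    qed simp
  qed
  have jump_fine: "p (A s) x *v n e = p (A s') x *v n e"
    "n e \<bullet> row_div (p (A s)) x = n e \<bullet> row_div (p (A s')) x"
    if e: "\<not> e \<subseteq> frontier \<Omega>" and s: "s \<in> Th" "s' \<in> Th" "e \<in> edges s" "e \<in> edges s'" and x: "x \<in> e"
    for e s s' x
  proof -
    have "p (A s) x *v n e = p (A s') x *v n e
      \<and> n e \<bullet> row_div (p (A s)) x = n e \<bullet> row_div (p (A s')) x"
    proof (cases "A s = A s'")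
      case False
      have nc: "noncollinear s"
        using forest_noncollinear[OF assms(5)] Th(2) s(1) by blast
      have "e \<subseteq> tri (A s)" "e \<subseteq> tri (A s')"
        using edge_subset_tri sub s by blast+
      from coarse_pair_at_fine_edge[OF TH(1) A(1)[OF s(1)] A(1)[OF s(2)] False this e s(3) nc]
      obtain f where f: "f \<in> interior_edges \<Omega> TH" "f \<in> edges (A s)" "f \<in> edges (A s')" "e \<subseteq> f"
        by metis
      then have xf: "x \<in> f"
        using x by blast
      \<comment> \<open>Both jump conditions are linear in the normal, so they pass from
        \<open>f\<close> to the smaller edge \<open>e\<close> whichever sign occurs.\<close>
      have "n e = n f \<or> n e = - n f"
        using normals_of_nested_edges[OF assms(6) _ _ nc f(2) s(3) f(4)] A(1) s(1) TH(2) Th(2) by blast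
      then show ?thesis
        using jump_vanishesD[OF jump[OF f(1)] A(1)[OF s(1)] A(1)[OF s(2)] f(2,3) xf]
          jump_vanishesD[OF jump_div[OF f(1)] A(1)[OF s(1)] A(1)[OF s(2)] f(2,3) xf]
        by (auto simp: matrix_vector_mult_uminus_right)
    qed simp
    then show "p (A s) x *v n e = p (A s') x *v n e"
      "n e \<bullet> row_div (p (A s)) x = n e \<bullet> row_div (p (A s')) x"
      by blast+
  qed
  show "\<tau> \<in> ext_moment_space \<Omega> T0 n k Th"
    unfolding ext_moment_space_def
  \<comment> \<open>The condition \<open>\<tau> \<in> Hdivdiv \<Omega>\<close> does not involve the
    mesh and carries over unchanged; the other conditions concern the inherited polynomials.\<close>
  proof (intro CollectI conjI exI[of _ "\<lambda>s. p (A s)"] ballI)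
    fix x assume "x \<in> mesh_verts T0"
    from old[OF this] show "traces_agree_at Th x (\<lambda>s. p (A s))"
      using A(1) sub unfolding traces_agree_at_def by blast
  next
    fix e assume e: "e \<in> interior_edges \<Omega> Th"
    show "jump_vanishes Th e (\<lambda>s y. p (A s) y *v n e)"
      "jump_vanishes Th e (\<lambda>s y. n e \<bullet> row_div (p (A s)) y)"
      using e jump_fine unfolding jump_vanishes_def interior_edges_def by blast+
  qed (use \<tau> poly A ae_fine tt_fine normal_fine in auto)
qed

end
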